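(* Let $s\in(0,\tfrac32)$. The finite element stiffness matrix $\boldsymbol S=(S_{kj})_{1\le k,j\le N-1}$ with entries $$S_{kj}=\int_{\mathbb R}|\xi|^{2s}\,\mathscr F[\phi_j](\xi)\,\overline{\mathscr F[\phi_k](\xi)}\,d\xi$$ is a symmetric Toeplitz matrix given by $$S_{kj}=\frac{h^{1-2s}}{2\,\Gamma(4-2s)\cos(s\pi)}\;t_{|k-j|},\qquad 1\le k,j\le N-1,$$ which is generated by the vector $(t_0,t_1,\dots,t_{N-2})$, where $$t_p=\sum_{i=-2}^{2}c_i\,|p+i|^{3-2s},\qquad c_0=6,\quad c_{\pm1}=-4,\quad c_{\pm2}=1.$$ In particular, if $s=\tfrac12$, the entries of $\boldsymbol S$ should be obtained by $$S_{kj}=\frac14\lim_{s\to\frac12}\frac{t_p}{\cos(s\pi)}=\frac1{2\pi}\sum_{i=-2}^{2}c_i\,(p+i)^2\ln|p+i|,\qquad p=|k-j|,$$ where $(p+i)^2\ln|p+i|$ is understood to be $0$ when $p+i=0$.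
   Context: Let $\Omega=(a,b)$ be a finite interval, $N\ge2$ an integer, $h=(b-a)/N$, and $x_j=a+jh$ for $0\le j\le N$ (uniform partition). For $1\le j\le N-1$ the piecewise linear nodal (hat) basis function $\phi_j:\mathbb R\to\mathbb R$ is the continuous function with $\phi_j(x)=\frac{x-x_{j-1}}h$ on $(x_{j-1},x_j)$, $\phi_j(x)=\frac{x_{j+1}-x}h$ on $(x_j,x_{j+1})$, and $\phi_j=0$ elsewhere on $\mathbb R$. The Fourier transform is $\mathscr F[u](\xi)=\frac1{\sqrt{2\pi}}\int_{\mathbb R}u(x)e^{-\mathrm i\xi x}\,dx$. The matrix $\boldsymbol S$ is the stiffness matrix of the fractional Laplacian $(-\Delta)^s u=\mathscr F^{-1}[|\xi|^{2s}\mathscr F[u]]$. *)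

theory Defs
  imports "HOL-Analysis.Analysis" "Jordan_Normal_Form.Matrix"
begin

definition mesh_size :: "real \<Rightarrow> real \<Rightarrow> nat \<Rightarrow> real" where
  "mesh_size a b N = (b - a) / real N"

definition node :: "real \<Rightarrow> real \<Rightarrow> nat \<Rightarrow> nat \<Rightarrow> real" where
  "node a b N j = a + real j * mesh_size a b N"

text \<open>The closed intervals encode continuity: the nodal values are
  \<open>1\<close> at the \<open>j\<close>-th node and \<open>0\<close> at its neighbours. Intended for \<open>1 \<le> j \<le> N - 1\<close>.\<close>

definition hat :: "real \<Rightarrow> real \<Rightarrow> nat \<Rightarrow> nat \<Rightarrow> real \<Rightarrow> real" where
  "hat a b N j x =
     (if node a b N (j - 1) \<le> x \<and> x \<le> node a b N j
        then (x - node a b N (j - 1)) / mesh_size a b N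
      else if node a b N j \<le> x \<and> x \<le> node a b N (j + 1)
        then (node a b N (j + 1) - x) / mesh_size a b N
      else 0)"

definition fourier :: "(real \<Rightarrow> complex) \<Rightarrow> real \<Rightarrow> complex" where
  "fourier u \<xi> = of_real (1 / sqrt (2 * pi)) *
     (LINT x|lborel. u x * exp (- \<i> * of_real \<xi> * of_real x))"

definition stiffness_integrand ::
  "real \<Rightarrow> real \<Rightarrow> nat \<Rightarrow> real \<Rightarrow> nat \<Rightarrow> nat \<Rightarrow> real \<Rightarrow> complex" where
  "stiffness_integrand a b N s k j \<xi> =
     of_real (\<bar>\<xi>\<bar> powr (2 * s)) *
     fourier (\<lambda>x. of_real (hat a b N j x)) \<xi> *
     cnj (fourier (\<lambda>x. of_real (hat a b N k x)) \<xi>)"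

text \<open>Matrix indices start at \<open>0\<close>, basis functions at \<open>1\<close>.\<close>

definition stiffness_mat :: "real \<Rightarrow> real \<Rightarrow> nat \<Rightarrow> real \<Rightarrow> complex mat" where
  "stiffness_mat a b N s = Matrix.mat (N - 1) (N - 1)
     (\<lambda>(k, j). LINT \<xi>|lborel. stiffness_integrand a b N s (k + 1) (j + 1) \<xi>)"

definition symmetric_mat :: "'a mat \<Rightarrow> bool" where
  "symmetric_mat A \<longleftrightarrow> transpose_mat A = A"

definition toeplitz_mat :: "'a mat \<Rightarrow> bool" where
  "toeplitz_mat A \<longleftrightarrow>
     (\<forall>i j. i + 1 < dim_row A \<and> j + 1 < dim_col A \<longrightarrow> A $$ (i + 1, j + 1) = A $$ (i, j))"

definition stencil :: "int \<Rightarrow> real" where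
  "stencil i = (if i = 0 then 6 else if \<bar>i\<bar> = 1 then - 4 else if \<bar>i\<bar> = 2 then 1 else 0)"

definition toeplitz_gen :: "real \<Rightarrow> nat \<Rightarrow> real" where
  "toeplitz_gen s p = (\<Sum>i = - 2..2. stencil i * \<bar>real_of_int (int p + i)\<bar> powr (3 - 2 * s))"

text \<open>The summand with \<open>p + i = 0\<close> vanishes, since its factor \<open>(p + i)\<^sup>2\<close> does.\<close>

definition log_toeplitz_gen :: "nat \<Rightarrow> real" where
  "log_toeplitz_gen p =
     (\<Sum>i = - 2..2. stencil i * (real_of_int (int p + i))\<^sup>2 * ln \<bar>real_of_int (int p + i)\<bar>)"

definition index_dist :: "nat \<Rightarrow> nat \<Rightarrow> nat" where
  "index_dist k j = nat \<bar>int k - int j\<bar>"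

end

theory Submission
  imports Defs "HOL-Real_Asymp.Real_Asymp"
begin

text \<open>With \<open>h\<close> the mesh size, the Fourier transform of a hat function centred at the node \<open>x\<^sub>j\<close> is
\<open>(2 - 2 cos (h \<xi>)) / (sqrt (2\<pi>) h \<xi>\<^sup>2)\<close> times the phase of the node. In the product of two such
transforms the phases combine to \<open>cis ((k - j) h \<xi>)\<close>, so after rescaling by \<open>h\<close> and folding the real
line onto the half-line every entry of the stiffness matrix becomes \<open>h powr (1 - 2 s) / \<pi>\<close> times

\<open>J q p = \<integral>\<^sub>0\<^sup>\<infinity> x powr (- q) (2 - 2 cos x)\<^sup>2 cos (p x) dx\<close>,  where \<open>q = 4 - 2 s\<close> and \<open>p = |k - j|\<close>.

This settles integrability, symmetry and the Toeplitz property. The factor \<open>(2 - 2 cos x)\<^sup>2\<close> is the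
symbol of the fourth difference stencil \<open>(1, -4, 6, -4, 1)\<close>, so the trigonometric part of \<open>J\<close> equals
\<open>\<Sum>i. c\<^sub>i cos ((p + i) x)\<close>; it is of order \<open>x\<^sup>4\<close> at the origin, which makes the integral converge
although none of its five summands does.

To evaluate it without regularisation, \<open>x powr (- q)\<close> is written as a Laplace transform,
\<open>\<Gamma>(q) x powr (- q) = \<integral>\<^sub>0\<^sup>\<infinity> t powr (q - 1) exp (- t x) dt\<close>, and the integrals are exchanged. As the
Laplace transform of \<open>cos (m x)\<close> is \<open>t / (t\<^sup>2 + m\<^sup>2)\<close>, this gives

\<open>\<Gamma>(q) J q p = \<integral>\<^sub>0\<^sup>\<infinity> t powr q (\<Sum>i. c\<^sub>i / (t\<^sup>2 + m\<^sub>i\<^sup>2)) dt\<close>,  where \<open>m\<^sub>i = p + i\<close>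

(lemma \<open>has_bochner_integral_stencil_resolvent\<close>). The stencil annihilates constants and quadratic
polynomials, so two or four powers of \<open>t\<close> can be traded for the same powers of \<open>m\<^sub>i\<close>
(\<open>sum_stencil_resolvent\<close>). After the trade the five summands are separately integrable, and each is the
classical integral of \<open>t powr r / (t\<^sup>2 + m\<^sup>2)\<close> with \<open>|r| < 1\<close>
(\<open>has_bochner_integral_powr_over_square_add\<close>), which follows from the reflection formula. One trades two
powers when \<open>q < 3\<close> and four when \<open>q > 3\<close>; both give the same closed form
(\<open>symbol_integral_eq_power_sum\<close>).

At \<open>q = 3\<close>, that is \<open>s = 1/2\<close>, the exponent \<open>r\<close> is at the edge of the admissible range, but
\<open>\<Sum>i. c\<^sub>i m\<^sub>i\<^sup>2 t / (t\<^sup>2 + m\<^sub>i\<^sup>2)\<close> has an elementary logarithmic primitive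
(\<open>symbol_integral_three_eq_log_sum\<close>). The limit of the general formula at \<open>s = 1/2\<close> is computed
independently as a quotient of two derivatives (\<open>tendsto_toeplitz_gen_over_cos\<close>) and agrees.\<close>

section \<open>Gamma integrals and the Mellin transform of the resolvent\<close>


lemma einterval_0_infinity: "einterval 0 \<infinity> = {0<..}"
  by (auto simp: einterval_def)

lemma has_bochner_integral_powr_exp:
  fixes \<alpha> u :: real
  assumes "0 < \<alpha>" "0 < u"
  shows "has_bochner_integral lborel (\<lambda>t. indicator {0<..} t * (t powr (\<alpha> - 1) * exp (- t * u)))
           (Gamma \<alpha> * u powr (- \<alpha>))"
proof -
  have eq: "indicator {0..} t * t powr (\<alpha> - 1) / exp t
      = indicator {0<..} t * (t powr (\<alpha> - 1) * exp (- t))" for t :: real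
    by (auto simp: indicator_def exp_minus divide_inverse)
  have "has_bochner_integral lborel (\<lambda>t. indicator {0<..} t * (t powr (\<alpha> - 1) * exp (- t))) (Gamma \<alpha>)"
    using Gamma_conv_nn_integral_real[OF assms(1)] Gamma_real_pos[OF assms(1)]
    unfolding eq by (intro has_bochner_integral_nn_integral) (auto simp: less_imp_le)
  from lborel_has_bochner_integral_real_affine_iff[of u, THEN iffD1, OF _ this, of 0]
  have "has_bochner_integral lborel
      (\<lambda>t. indicator {0<..} (u * t) * ((u * t) powr (\<alpha> - 1) * exp (- (u * t)))) (Gamma \<alpha> / u)"
    using assms by (simp add: field_simps)
  then have "has_bochner_integral lborel
      (\<lambda>t. u powr (1 - \<alpha>) * (indicator {0<..} (u * t) * ((u * t) powr (\<alpha> - 1) * exp (- (u * t)))))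
      (u powr (1 - \<alpha>) * (Gamma \<alpha> / u))"
    by (intro has_bochner_integral_mult_right)
  also have "(\<lambda>t. u powr (1 - \<alpha>) * (indicator {0<..} (u * t) * ((u * t) powr (\<alpha> - 1) * exp (- (u * t)))))
     = (\<lambda>t. indicator {0<..} t * (t powr (\<alpha> - 1) * exp (- t * u)))"
  proof
    fix t :: real
    have "u powr (1 - \<alpha>) * (u powr (\<alpha> - 1)) = 1"
      using assms by (simp flip: powr_add)
    then show "u powr (1 - \<alpha>) * (indicator {0<..} (u * t) * ((u * t) powr (\<alpha> - 1) * exp (- (u * t))))
        = indicator {0<..} t * (t powr (\<alpha> - 1) * exp (- t * u))"
      using assms by (auto simp: indicator_def powr_mult zero_less_mult_iff mult_ac)
  qed
  also have "u powr (1 - \<alpha>) * (Gamma \<alpha> / u) = Gamma \<alpha> * u powr (- \<alpha>)"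
    using assms by (simp add: powr_diff powr_minus field_simps)
  finally show ?thesis .
qed

lemma Gamma_reflection_real:
  assumes "0 < x" "x < (1::real)"
  shows "Gamma x * Gamma (1 - x) = pi / sin (pi * x)"
proof -
  have "complex_of_real (Gamma x * Gamma (1 - x)) = complex_of_real (pi / sin (pi * x))"
    using Gamma_reflection_complex[of "of_real x"] Gamma_complex_of_real[of x]
      Gamma_complex_of_real[of "1 - x"] sin_of_real[of "pi * x", where 'a = complex]
    by simp
  then show ?thesis by (simp only: of_real_eq_iff)
qed

text \<open>Writing \<open>1 / (v + c)\<close> as \<open>\<integral>\<^sub>0\<^sup>\<infinity> exp (- u (v + c)) du\<close> and exchanging the two integrals, which is free
since everything is nonnegative, splits this into the Gamma integrals at \<open>a\<close> and at \<open>1 - a\<close>; the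
reflection formula evaluates their product.\<close>

lemma has_bochner_integral_powr_over_add:
  fixes a c :: real
  assumes "0 < a" "a < 1" "0 < c"
  shows "has_bochner_integral lborel (\<lambda>v. indicator {0<..} v * (v powr (a - 1) / (v + c)))
           (pi / sin (pi * a) * c powr (a - 1))"
proof -
  let ?f = "\<lambda>v u. indicator {0<..} v * indicator {0<..} u * (v powr (a - 1) * exp (- u * (v + c))) :: real"
  have "(\<integral>\<^sup>+v. ennreal (indicator {0<..} v * (v powr (a - 1) / (v + c))) \<partial>lborel)
      = (\<integral>\<^sup>+v. (\<integral>\<^sup>+u. ennreal (?f v u) \<partial>lborel) \<partial>lborel)"
  proof (intro nn_integral_cong)
    fix v :: real
    have "has_bochner_integral lborel (?f v) (indicator {0<..} v * (v powr (a - 1) / (v + c)))"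
    proof (cases "v > 0")
      case True
      have "has_bochner_integral lborel
          (\<lambda>u. v powr (a - 1) * (indicator {0<..} u * (u powr (1 - 1) * exp (- u * (v + c)))))
          (v powr (a - 1) * (Gamma 1 * (v + c) powr (- 1)))"
        using True assms
        by (intro has_bochner_integral_mult_right has_bochner_integral_powr_exp) auto
      also have "(\<lambda>u. v powr (a - 1) * (indicator {0<..} u * (u powr (1 - 1) * exp (- u * (v + c))))) = ?f v"
        using True by (auto simp: indicator_def)
      finally show ?thesis using True assms by (simp add: powr_minus_divide)
    qed (simp add: has_bochner_integral_zero)
    from has_bochner_integral_integral_eq[OF this] nn_integral_eq_integral[OF integrable.intros[OF this]]
    show "ennreal (indicator {0<..} v * (v powr (a - 1) / (v + c))) = (\<integral>\<^sup>+u. ennreal (?f v u) \<partial>lborel)"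
      by simp
  qed
  also have "\<dots> = (\<integral>\<^sup>+u. (\<integral>\<^sup>+v. ennreal (?f v u) \<partial>lborel) \<partial>lborel)"
    by (rule lborel_pair.Fubini') measurable
  also have "\<dots> = (\<integral>\<^sup>+u. ennreal (Gamma a * (indicator {0<..} u * (u powr (- a) * exp (- u * c)))) \<partial>lborel)"
  proof (intro nn_integral_cong)
    fix u :: real
    have "has_bochner_integral lborel (\<lambda>v. ?f v u) (Gamma a * (indicator {0<..} u * (u powr (- a) * exp (- u * c))))"
    proof (cases "u > 0")
      case True
      have "has_bochner_integral lborel
          (\<lambda>v. exp (- u * c) * (indicator {0<..} v * (v powr (a - 1) * exp (- v * u))))
          (exp (- u * c) * (Gamma a * u powr (- a)))"
        using True assms
        by (intro has_bochner_integral_mult_right has_bochner_integral_powr_exp) auto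
      also have "(\<lambda>v. exp (- u * c) * (indicator {0<..} v * (v powr (a - 1) * exp (- v * u)))) = (\<lambda>v. ?f v u)"
        using True by (auto simp: indicator_def exp_add[symmetric] exp_diff exp_minus field_simps)
      finally show ?thesis using True by (simp add: mult_ac)
    qed (simp add: has_bochner_integral_zero)
    from has_bochner_integral_integral_eq[OF this] nn_integral_eq_integral[OF integrable.intros[OF this]]
    show "(\<integral>\<^sup>+v. ennreal (?f v u) \<partial>lborel) = ennreal (Gamma a * (indicator {0<..} u * (u powr (- a) * exp (- u * c))))"
      by simp
  qed
  also have "\<dots> = ennreal (Gamma a * (Gamma (1 - a) * c powr (a - 1)))"
  proof -
    have 1: "has_bochner_integral lborel (\<lambda>u. Gamma a * (indicator {0<..} u * (u powr (- a) * exp (- u * c))))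
        (Gamma a * (Gamma (1 - a) * c powr (a - 1)))"
      using has_bochner_integral_powr_exp[of "1 - a" c] assms
      by (intro has_bochner_integral_mult_right) simp
    show ?thesis unfolding has_bochner_integral_integral_eq[OF 1, symmetric]
      using Gamma_real_pos[of a] assms
      by (intro nn_integral_eq_integral integrable.intros[OF 1]) auto
  qed
  also have "Gamma a * (Gamma (1 - a) * c powr (a - 1)) = pi / sin (pi * a) * c powr (a - 1)"
    using Gamma_reflection_real[of a] assms by (metis mult.assoc)
  finally have *: "(\<integral>\<^sup>+v. ennreal (indicator {0<..} v * (v powr (a - 1) / (v + c))) \<partial>lborel)
      = ennreal (pi / sin (pi * a) * c powr (a - 1))" .
  have "0 < sin (pi * a)" using assms by (intro sin_gt_zero) auto
  then show ?thesis
    using assms by (intro has_bochner_integral_nn_integral *) (auto simp: indicator_def)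
qed

text \<open>The substitution \<open>t = sqrt v\<close> turns this into the previous integral with \<open>a = (r + 1) / 2\<close> and
\<open>c = m\<^sup>2\<close>.\<close>

lemma has_bochner_integral_powr_over_square_add:
  fixes r m :: real
  assumes "-1 < r" "r < 1" "0 < m"
  shows "has_bochner_integral lborel (\<lambda>t. indicator {0<..} t * (t powr r / (t\<^sup>2 + m\<^sup>2)))
           (m powr (r - 1) * pi / (2 * cos (pi * r / 2)))"
proof -
  let ?f = "\<lambda>t. t powr r / (t\<^sup>2 + m\<^sup>2)"
  \<comment> \<open>The exponent for which \<open>sqrt v powr r / (2 sqrt v) = v powr (a - 1) / 2\<close>.\<close>
  define a where "a = (r + 1) / 2"
  have a: "0 < a" "a < 1" using assms by (auto simp: a_def)
  note I = has_bochner_integral_powr_over_add[OF a, of "m\<^sup>2"]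
  have eq: "indicator (einterval 0 \<infinity>) v *\<^sub>R (?f (sqrt v) * (inverse (sqrt v) / 2))
      = 1/2 * (indicator {0<..} v * (v powr (a - 1) / (v + m\<^sup>2)))" for v
  proof (cases "v > 0")
    case True
    have "sqrt v = v powr (1 / 2)" using True by (simp add: powr_half_sqrt)
    then have "sqrt v powr r * inverse (sqrt v) = v powr (r / 2) * inverse (v powr (1 / 2))"
      by (simp only: powr_powr) simp
    also have "\<dots> = v powr (r / 2 - 1 / 2)"
      by (simp only: powr_diff divide_inverse)
    also have "r / 2 - 1 / 2 = a - 1" by (simp add: a_def field_simps)
    finally have *: "sqrt v powr r * inverse (sqrt v) = v powr (a - 1)" .
    have "?f (sqrt v) * (inverse (sqrt v) / 2)
        = 1 / 2 * ((sqrt v powr r * inverse (sqrt v)) / (v + m\<^sup>2))"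
      using True by simp
    then show ?thesis using True unfolding * by (simp add: einterval_def indicator_def)
  qed (simp add: einterval_def)
  have J: "has_bochner_integral lborel (\<lambda>v. indicator (einterval 0 \<infinity>) v *\<^sub>R (?f (sqrt v) * (inverse (sqrt v) / 2)))
      (1/2 * (pi / sin (pi * a) * (m\<^sup>2) powr (a - 1)))"
    unfolding eq using I assms(3) by (intro has_bochner_integral_mult_right) auto
  have lim0: "((ereal \<circ> sqrt \<circ> real_of_ereal) \<longlongrightarrow> 0) (at_right 0)"
  proof -
    have "(sqrt \<longlongrightarrow> 0) (at_right 0)" by real_asymp
    then have "((ereal \<circ> sqrt \<circ> real_of_ereal) \<longlongrightarrow> ereal 0) (at_right (ereal 0))"
      unfolding ereal_tendsto_simps .
    then show ?thesis by (simp only: zero_ereal_def)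
  qed
  have lim_inf: "((ereal \<circ> sqrt \<circ> real_of_ereal) \<longlongrightarrow> \<infinity>) (at_left \<infinity>)"
    unfolding ereal_tendsto_simps by (rule sqrt_at_top)
  have int: "set_integrable lborel (einterval 0 \<infinity>) (\<lambda>x. ?f (sqrt x) * (inverse (sqrt x) / 2))"
    using J unfolding set_integrable_def by (rule integrable.intros)
  have deriv: "DERIV sqrt v :> inverse (sqrt v) / 2" if "0 < ereal v" for v
    using that by (auto intro!: derivative_eq_intros)
  have cont_f: "isCont ?f (sqrt v)" if "0 < ereal v" for v
    using that assms(3) by (auto intro!: continuous_intros simp: add_nonneg_eq_0_iff)
  have cont_g': "isCont (\<lambda>v. inverse (sqrt v) / 2) v" if "0 < ereal v" for v
    using that by (auto intro!: continuous_intros)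
  note subst = interval_integral_substitution_nonneg[where f = ?f and g = sqrt
      and g' = "\<lambda>v. inverse (sqrt v) / 2" and a = 0 and b = \<infinity>,
      OF _ deriv cont_f cont_g' _ _ lim0 lim_inf int]
  have "set_integrable lborel (einterval 0 \<infinity>) ?f"
    by (rule subst(1)) auto
  moreover have "(LBINT x=0..\<infinity>. ?f x) = (LBINT x=0..\<infinity>. (?f (sqrt x) * (inverse (sqrt x) / 2)))"
    by (rule subst(2)) auto
  moreover have "(LBINT x=0..\<infinity>. (?f (sqrt x) * (inverse (sqrt x) / 2)))
      = 1/2 * (pi / sin (pi * a) * (m\<^sup>2) powr (a - 1))"
    using has_bochner_integral_integral_eq[OF J]
    by (simp only: interval_lebesgue_integral_0_infty set_lebesgue_integral_def einterval_0_infinity)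
  ultimately have "has_bochner_integral lborel (\<lambda>t. indicator {0<..} t * ?f t)
      (1/2 * (pi / sin (pi * a) * (m\<^sup>2) powr (a - 1)))"
    by (simp only: has_bochner_integral_iff set_integrable_def interval_lebesgue_integral_0_infty
         set_lebesgue_integral_def einterval_0_infinity real_scaleR_def)
  also have "sin (pi * a) = cos (pi * r / 2)"
  proof -
    have "pi * a = pi / 2 + pi * r / 2" by (simp add: a_def field_simps)
    then show ?thesis by (simp only: sin_add) simp
  qed
  also have "(m\<^sup>2) powr (a - 1) = m powr (r - 1)"
  proof -
    have "(m\<^sup>2) powr (a - 1) = (m powr 2) powr (a - 1)" using assms(3) by simp
    also have "\<dots> = m powr (r - 1)" unfolding powr_powr
      by (rule arg_cong[where f = "(powr) m"]) (simp add: a_def field_simps)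
    finally show ?thesis .
  qed
  also have "1 / 2 * (pi / cos (pi * r / 2) * m powr (r - 1)) = m powr (r - 1) * pi / (2 * cos (pi * r / 2))"
    by simp
  finally show ?thesis .
qed

section \<open>Laplace transforms\<close>

lemma has_bochner_integral_exp_cos:
  fixes u m :: real
  assumes "0 < u"
  shows "has_bochner_integral lborel (\<lambda>x. indicator {0<..} x * (exp (- u * x) * cos (m * x)))
           (u / (u\<^sup>2 + m\<^sup>2))"
proof -
  let ?f = "\<lambda>x. exp (- u * x) * cos (m * x)"
  let ?F = "\<lambda>x. exp (- u * x) * (m * sin (m * x) - u * cos (m * x)) / (u\<^sup>2 + m\<^sup>2)"
  have pos: "u\<^sup>2 + m\<^sup>2 > 0" using assms by (simp add: add_pos_nonneg)
  have dom: "integrable lborel (\<lambda>x. indicator {0<..} x * (x powr (1 - 1) * exp (- x * u)))"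
    using has_bochner_integral_powr_exp[of 1 u] assms by (auto simp: has_bochner_integral_iff)
  have int: "integrable lborel (\<lambda>x. indicator {0<..} x * ?f x)"
  proof (rule Bochner_Integration.integrable_bound[OF dom])
    show "AE x in lborel. norm (indicator {0<..} x * ?f x)
        \<le> norm (indicator {0<..} x * (x powr (1 - 1) * exp (- x * u)))"
      by (auto simp: indicator_def abs_mult mult.commute intro!: AE_I2 mult_left_le)
  qed measurable
  have lim0: "((?F \<circ> real_of_ereal) \<longlongrightarrow> ?F 0) (at_right 0)"
  proof -
    have "(?F \<longlongrightarrow> ?F 0) (at_right 0)"
      using pos by (intro tendsto_intros) auto
    then have "((?F \<circ> real_of_ereal) \<longlongrightarrow> ?F 0) (at_right (ereal 0))"
      unfolding ereal_tendsto_simps .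
    then show ?thesis by (simp only: zero_ereal_def)
  qed
  have lim_inf: "((?F \<circ> real_of_ereal) \<longlongrightarrow> 0) (at_left \<infinity>)"
    unfolding ereal_tendsto_simps
  proof (rule Lim_null_comparison)
    show "((\<lambda>x. exp (- u * x) * ((\<bar>m\<bar> + \<bar>u\<bar>) / (u\<^sup>2 + m\<^sup>2))) \<longlongrightarrow> 0) at_top"
      using assms by real_asymp
    have "\<bar>m * sin (m * x) - u * cos (m * x)\<bar> \<le> \<bar>m\<bar> + \<bar>u\<bar>" for x
    proof -
      have "\<bar>m * sin (m * x)\<bar> \<le> \<bar>m\<bar>" "\<bar>u * cos (m * x)\<bar> \<le> \<bar>u\<bar>"
        by (simp_all add: abs_mult mult_left_le)
      then show ?thesis by linarith
    qed
    then show "\<forall>\<^sub>F x in at_top. norm (?F x) \<le> exp (- u * x) * ((\<bar>m\<bar> + \<bar>u\<bar>) / (u\<^sup>2 + m\<^sup>2))"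
      using pos by (intro always_eventually allI) (simp add: abs_mult divide_right_mono)
  qed
  have deriv: "(?F has_vector_derivative ?f x) (at x)" for x
  proof -
    have "((\<lambda>x. exp (- u * x) * (m * sin (m * x) - u * cos (m * x)))
        has_real_derivative (u\<^sup>2 + m\<^sup>2) * ?f x) (at x)"
      by (auto intro!: derivative_eq_intros simp: algebra_simps power2_eq_square)
    from DERIV_cdivide[OF this, of "u\<^sup>2 + m\<^sup>2"] have "(?F has_real_derivative ?f x) (at x)"
      using assms by simp
    then show ?thesis by (simp add: has_real_derivative_iff_has_vector_derivative)
  qed
  have "(LBINT x=0..\<infinity>. ?f x) = 0 - ?F 0"
    using int by (intro interval_integral_FTC_integrable[where F = ?F] deriv lim0 lim_inf)
      (auto simp: einterval_0_infinity set_integrable_def)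
  then have "(LINT x|lborel. indicator {0<..} x * ?f x) = 0 - ?F 0"
    by (simp only: interval_lebesgue_integral_0_infty set_lebesgue_integral_def einterval_0_infinity real_scaleR_def)
  with int show ?thesis by (simp add: has_bochner_integral_iff)
qed

text \<open>Integration against \<open>x powr (- q)\<close> becomes integration of the Laplace transform against
\<open>t powr (q - 1)\<close>. Fubini applies because integrating the modulus of the kernel over \<open>t\<close> first gives back
\<open>\<Gamma>(q)\<close> times the modulus of the given integrand.\<close>

lemma integral_powr_minus_eq_laplace:
  fixes f :: "real \<Rightarrow> real" and q :: real
  assumes q: "0 < q" and f [measurable]: "f \<in> borel_measurable borel"
    and int: "integrable lborel (\<lambda>x. indicator {0<..} x * (x powr (- q) * f x))"
  shows "has_bochner_integral lborel
           (\<lambda>t. indicator {0<..} t * (t powr (q - 1) *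
              (LINT x|lborel. indicator {0<..} x * (exp (- t * x) * f x))))
           (Gamma q * (LINT x|lborel. indicator {0<..} x * (x powr (- q) * f x)))"
proof -
  let ?k = "\<lambda>f x t. indicator {0<..} x * indicator {0<..} t * (t powr (q - 1) * exp (- t * x) * f x)"
  have inner: "has_bochner_integral lborel (\<lambda>t. ?k f x t) (Gamma q * (indicator {0<..} x * (x powr (- q) * f x)))"
    for x and f :: "real \<Rightarrow> real"
  proof (cases "x > 0")
    case True
    have "has_bochner_integral lborel
        (\<lambda>t. f x * (indicator {0<..} t * (t powr (q - 1) * exp (- t * x)))) (f x * (Gamma q * x powr (- q)))"
      using True q by (intro has_bochner_integral_mult_right has_bochner_integral_powr_exp)
    then show ?thesis using True by (simp add: mult_ac)
  qed (simp add: has_bochner_integral_zero)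
  have norm_k: "norm (?k f x t) = ?k (\<lambda>x. \<bar>f x\<bar>) x t" for x t
    by (simp add: abs_mult)
  have joint: "integrable (lborel \<Otimes>\<^sub>M lborel) (\<lambda>(x, t). ?k f x t)"
  proof (rule lborel_pair.Fubini_integrable)
    have "(\<lambda>x. LINT t|lborel. norm (case (x, t) of (x, t) \<Rightarrow> ?k f x t))
        = (\<lambda>x. Gamma q * norm (indicator {0<..} x * (x powr (- q) * f x)))"
      unfolding prod.case norm_k
      by (intro ext, subst has_bochner_integral_integral_eq[OF inner]) (auto simp: abs_mult)
    then show "integrable lborel (\<lambda>x. LINT t|lborel. norm (case (x, t) of (x, t) \<Rightarrow> ?k f x t))"
      using int by (simp del: real_norm_def)
    show "AE x in lborel. integrable lborel (\<lambda>t. case (x, t) of (x, t) \<Rightarrow> ?k f x t)"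
      using inner by (auto intro!: AE_I2 intro: integrable.intros)
  qed measurable
  have outer: "(LINT x|lborel. ?k f x t) = indicator {0<..} t * (t powr (q - 1) *
              (LINT x|lborel. indicator {0<..} x * (exp (- t * x) * f x)))" for t
  proof -
    have "(LINT x|lborel. ?k f x t) = (LINT x|lborel. (indicator {0<..} t * t powr (q - 1)) *
              (indicator {0<..} x * (exp (- t * x) * f x)))"
      by (intro Bochner_Integration.integral_cong) auto
    then show ?thesis by simp
  qed
  have "integrable lborel (\<lambda>t. LINT x|lborel. ?k f x t)"
    using lborel_pair.integrable_snd[OF joint] by simp
  moreover have "(LINT t|lborel. LINT x|lborel. ?k f x t)
      = (LINT x|lborel. LINT t|lborel. ?k f x t)"
    using lborel_pair.Fubini_integral[OF joint] by simp
  moreover have "\<dots> = Gamma q * (LINT x|lborel. indicator {0<..} x * (x powr (- q) * f x))"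
    using has_bochner_integral_integral_eq[OF inner] by simp
  ultimately show ?thesis
    unfolding outer by (simp add: has_bochner_integral_iff)
qed

section \<open>The fourth difference stencil\<close>

lemma sum_stencil: "(\<Sum>i = - 2..2. stencil i * g i) = g (-2) - 4 * g (-1) + 6 * g 0 - 4 * g 1 + g 2"
proof -
  have "{-2..2::int} = {-2, -1, 0, 1, 2}" by auto
  then show ?thesis by (simp add: stencil_def)
qed

text \<open>Shifts by \<open>i\<close> act on the oscillation of frequency \<open>x\<close> through \<open>cis (i x)\<close>, so the stencil acts by
multiplication with its symbol. The second difference has symbol \<open>2 cos x - 2\<close>, the fourth its square.\<close>

lemma sum_stencil_cos:
  "(\<Sum>i = - 2..2. stencil i * cos ((p + real_of_int i) * x)) = (2 - 2 * cos x)\<^sup>2 * cos (p * x)"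
proof -
  have "(\<Sum>i = - 2..2. stencil i * cos ((p + real_of_int i) * x))
      = (cos (p * x + 2 * x) + cos (p * x - 2 * x)) - 4 * (cos (p * x + x) + cos (p * x - x)) + 6 * cos (p * x)"
    unfolding sum_stencil by (simp add: distrib_right left_diff_distrib)
  also have "cos (p * x + 2 * x) + cos (p * x - 2 * x) = 2 * cos (p * x) * (2 * (cos x)\<^sup>2 - 1)"
    unfolding cos_add cos_diff cos_double_cos by simp
  also have "cos (p * x + x) + cos (p * x - x) = 2 * cos (p * x) * cos x"
    unfolding cos_add cos_diff by simp
  finally show ?thesis
    by (simp add: power2_eq_square algebra_simps)
qed

lemma sum_stencil_square: "(\<Sum>i = - 2..2. stencil i * (p + real_of_int i)\<^sup>2) = 0"
  unfolding sum_stencil by (simp add: power2_eq_square algebra_simps)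

lemma sum_stencil_const: "(\<Sum>i = - 2..2. stencil i * c) = 0"
  by (simp add: sum_stencil)

text \<open>Expanding \<open>t\<^sup>2 / (t\<^sup>2 + m\<^sup>2) = 1 - m\<^sup>2 / (t\<^sup>2 + m\<^sup>2)\<close>, and once more for \<open>t ^ 4\<close>, produces polynomial terms
of degree at most two in \<open>m\<close>, which the fourth difference annihilates.\<close>

lemma sum_stencil_resolvent:
  fixes t p :: real
  assumes "t > 0"
  defines "m \<equiv> \<lambda>i. p + real_of_int i"
  shows "t\<^sup>2 * (\<Sum>i = - 2..2. stencil i * (1 / (t\<^sup>2 + (m i)\<^sup>2)))
        = - (\<Sum>i = - 2..2. stencil i * ((m i)\<^sup>2 / (t\<^sup>2 + (m i)\<^sup>2)))" (is ?A)
    and "t ^ 4 * (\<Sum>i = - 2..2. stencil i * (1 / (t\<^sup>2 + (m i)\<^sup>2)))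
        = (\<Sum>i = - 2..2. stencil i * ((m i) ^ 4 / (t\<^sup>2 + (m i)\<^sup>2)))" (is ?B)
proof -
  have pos: "t\<^sup>2 + x\<^sup>2 \<noteq> 0" for x
    using assms by (simp add: add_nonneg_eq_0_iff)
  have "t\<^sup>2 * (\<Sum>i = - 2..2. stencil i * (1 / (t\<^sup>2 + (m i)\<^sup>2)))
      = (\<Sum>i = - 2..2. stencil i * 1 - stencil i * ((m i)\<^sup>2 / (t\<^sup>2 + (m i)\<^sup>2)))"
    unfolding sum_distrib_left using pos
    by (intro sum.cong refl) (simp add: field_simps)
  then show ?A by (simp only: sum_subtractf sum_stencil_const)
  have "t ^ 4 * (\<Sum>i = - 2..2. stencil i * (1 / (t\<^sup>2 + (m i)\<^sup>2)))
      = (\<Sum>i = - 2..2. stencil i * t\<^sup>2 - stencil i * (m i)\<^sup>2 + stencil i * ((m i) ^ 4 / (t\<^sup>2 + (m i)\<^sup>2)))"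
    unfolding sum_distrib_left using pos
    by (intro sum.cong refl) (simp add: field_simps power2_eq_square power4_eq_xxxx)
  then show ?B
    by (simp only: sum_subtractf sum.distrib sum_stencil_const sum_stencil_square m_def diff_self add_0)
qed

section \<open>The integral of the stencil symbol against a power\<close>

text \<open>Since \<open>0 \<le> 2 - 2 cos x \<le> min 4 (x\<^sup>2)\<close>, the integrand is at most \<open>x powr (4 - q)\<close> near the origin and
\<open>16 x powr (- q)\<close> at infinity, which is where the two bounds on \<open>q\<close> come from.\<close>

lemma integrable_powr_minus_times_one_minus_cos:
  fixes q :: real
  assumes "1 < q" "q < 5"
  shows "integrable lborel (\<lambda>x. indicator {0<..} x * (x powr (- q) * (2 - 2 * cos x)\<^sup>2))"
proof -
  have cos_le: "(2 - 2 * cos x)\<^sup>2 \<le> 16" "(2 - 2 * cos x)\<^sup>2 \<le> x ^ 4" for x :: real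
  proof -
    have "2 - 2 * cos x = 4 * (sin (x / 2))\<^sup>2"
      using cos_double_sin[of "x / 2"] by simp
    then have *: "(2 - 2 * cos x)\<^sup>2 = 16 * (sin (x / 2)) ^ 4"
      by (simp add: power_mult_distrib flip: power_mult)
    have "\<bar>sin (x / 2)\<bar> ^ 4 \<le> 1 ^ 4" by (intro power_mono) auto
    then show "(2 - 2 * cos x)\<^sup>2 \<le> 16" unfolding * by simp
    have "\<bar>sin (x / 2)\<bar> ^ 4 \<le> \<bar>x / 2\<bar> ^ 4" by (intro power_mono abs_sin_x_le_abs_x) auto
    then show "(2 - 2 * cos x)\<^sup>2 \<le> x ^ 4" unfolding * by (simp add: power_divide)
  qed
  have lborel: "integrable lborel (\<lambda>x. x powr r * indicator A x)"
    if "(\<lambda>x. x powr r) integrable_on A" and [measurable]: "A \<in> sets borel" for r :: real and A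
  proof -
    have "(\<lambda>x. x powr r) absolutely_integrable_on A"
      using that by (intro nonnegative_absolutely_integrable_1) auto
    then show ?thesis
      by (simp add: set_integrable_def integrable_completion mult.commute)
  qed
  have near: "integrable lborel (\<lambda>x. x powr (4 - q) * indicator {0..1} x)"
    using assms by (intro lborel integrable_on_powr_from_0) auto
  have far: "integrable lborel (\<lambda>x. x powr (- q) * indicator {1..} x)"
    using has_integral_powr_to_inf[of "- q" 1] assms by (intro lborel) (auto simp: integrable_on_def)
  show ?thesis
  proof (rule Bochner_Integration.integrable_bound)
    show "integrable lborel (\<lambda>x. x powr (4 - q) * indicator {0..1} x + 16 * (x powr (- q) * indicator {1..} x))"
      using near far by simp
    have "indicator {0<..} x * (x powr (- q) * (2 - 2 * cos x)\<^sup>2)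
       \<le> x powr (4 - q) * indicator {0..1} x + 16 * (x powr (- q) * indicator {1..} x)" for x :: real
    proof (cases "0 < x \<and> x \<le> 1")
      case True
      have "x powr (- q) * (2 - 2 * cos x)\<^sup>2 \<le> x powr (- q) * x ^ 4"
        by (intro mult_left_mono cos_le) auto
      also have "\<dots> = x powr (4 - q)"
        using True by (simp add: powr_minus powr_diff field_simps)
      finally show ?thesis using True by (auto simp: indicator_def)
    next
      case False
      then show ?thesis
        using mult_left_mono[OF cos_le(1)[of x], of "x powr (- q)"] by (auto simp: indicator_def)
    qed
    then show "AE x in lborel. norm (indicator {0<..} x * (x powr (- q) * (2 - 2 * cos x)\<^sup>2))
       \<le> norm (x powr (4 - q) * indicator {0..1} x + 16 * (x powr (- q) * indicator {1..} x))"
      by (intro AE_I2) (smt (verit) abs_ge_self abs_of_nonneg indicator_pos_le mult_nonneg_nonneg powr_ge_zero real_norm_def zero_le_power2)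
  qed measurable
qed



lemma integrable_symbol_integrand:
  fixes p q :: real
  assumes "1 < q" "q < 5"
  shows "integrable lborel
           (\<lambda>x. indicator {0<..} x * (x powr (- q) * ((2 - 2 * cos x)\<^sup>2 * cos (p * x))))"
  by (rule Bochner_Integration.integrable_bound[OF integrable_powr_minus_times_one_minus_cos[OF assms]])
    (auto simp: abs_mult indicator_def intro!: AE_I2 mult_left_mono mult_left_le)

text \<open>This is \<open>J q p\<close>, the integral to which each matrix entry reduces; \<open>q\<close> stands for \<open>4 - 2 s\<close> and \<open>p\<close> for
the distance from the diagonal.\<close>

definition symbol_integral :: "real \<Rightarrow> real \<Rightarrow> real" where
  "symbol_integral q p =
     (LINT x|lborel. indicator {0<..} x * (x powr (- q) * ((2 - 2 * cos x)\<^sup>2 * cos (p * x))))"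

text \<open>The Laplace transform of \<open>(2 - 2 cos x)\<^sup>2 cos (p x) = \<Sum>i. c\<^sub>i cos ((p + i) x)\<close> is
\<open>t (\<Sum>i. c\<^sub>i / (t\<^sup>2 + (p + i)\<^sup>2))\<close>; its factor \<open>t\<close> raises \<open>t powr (q - 1)\<close> to \<open>t powr q\<close>.\<close>

lemma has_bochner_integral_stencil_resolvent:
  fixes p q :: real
  assumes "1 < q" "q < 5"
  shows "has_bochner_integral lborel
           (\<lambda>t. indicator {0<..} t *
              (t powr q * (\<Sum>i = - 2..2. stencil i * (1 / (t\<^sup>2 + (p + real_of_int i)\<^sup>2)))))
           (Gamma q * symbol_integral q p)"
proof -
  have laplace: "(LINT x|lborel. indicator {0<..} x * (exp (- t * x) * ((2 - 2 * cos x)\<^sup>2 * cos (p * x))))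
      = t * (\<Sum>i = - 2..2. stencil i * (1 / (t\<^sup>2 + (p + real_of_int i)\<^sup>2)))"
    if "t > 0" for t
  proof -
    have "has_bochner_integral lborel
       (\<lambda>x. \<Sum>i = - 2..2. stencil i * (indicator {0<..} x * (exp (- t * x) * cos ((p + real_of_int i) * x))))
       (\<Sum>i = - 2..2. stencil i * (t / (t\<^sup>2 + (p + real_of_int i)\<^sup>2)))"
      using that
      by (intro has_bochner_integral_sum has_bochner_integral_mult_right has_bochner_integral_exp_cos)
    also have "(\<lambda>x. \<Sum>i = - 2..2. stencil i * (indicator {0<..} x * (exp (- t * x) * cos ((p + real_of_int i) * x))))
      = (\<lambda>x. indicator {0<..} x * (exp (- t * x) * (\<Sum>i = - 2..2. stencil i * cos ((p + real_of_int i) * x))))"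
      by (simp add: sum_distrib_left mult_ac)
    finally show ?thesis
      unfolding sum_stencil_cos
      by (simp add: has_bochner_integral_integral_eq sum_distrib_left mult_ac)
  qed
  have eq: "indicator {0<..} t * (t powr (q - 1) *
              (LINT x|lborel. indicator {0<..} x * (exp (- t * x) * ((2 - 2 * cos x)\<^sup>2 * cos (p * x)))))
       = indicator {0<..} t *
              (t powr q * (\<Sum>i = - 2..2. stencil i * (1 / (t\<^sup>2 + (p + real_of_int i)\<^sup>2))))" for t
  proof (cases "t > 0")
    case True
    then have "t powr (q - 1) * t = t powr q"
      by (simp add: powr_diff)
    then show ?thesis using True unfolding laplace[OF True] by (simp flip: mult.assoc)
  qed simp
  have "(\<lambda>x. (2 - 2 * cos x)\<^sup>2 * cos (p * x)) \<in> borel_measurable borel" by measurable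
  from integral_powr_minus_eq_laplace[OF _ this integrable_symbol_integrand[OF assms]] assms
  show ?thesis unfolding eq symbol_integral_def by simp
qed

text \<open>Multiplying by a positive power of \<open>|m|\<close> makes the formula valid at \<open>m = 0\<close> too, where both sides
vanish because \<open>0 powr y = 0\<close> for every \<open>y\<close>.\<close>

lemma has_bochner_integral_weighted_resolvent:
  fixes r m :: real and n :: nat
  assumes "-1 < r" "r < 1" "n > 0"
  shows "has_bochner_integral lborel
           (\<lambda>t. indicator {0<..} t * (t powr r * (\<bar>m\<bar> ^ n / (t\<^sup>2 + m\<^sup>2))))
           (\<bar>m\<bar> powr (r - 1 + n) * pi / (2 * cos (pi * r / 2)))"
proof (cases "m = 0")
  case False
  have "has_bochner_integral lborel
      (\<lambda>t. \<bar>m\<bar> ^ n * (indicator {0<..} t * (t powr r / (t\<^sup>2 + \<bar>m\<bar>\<^sup>2))))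
      (\<bar>m\<bar> ^ n * (\<bar>m\<bar> powr (r - 1) * pi / (2 * cos (pi * r / 2))))"
    using assms False
    by (intro has_bochner_integral_mult_right has_bochner_integral_powr_over_square_add) auto
  moreover have "\<bar>m\<bar> powr (r - 1 + n) = \<bar>m\<bar> ^ n * \<bar>m\<bar> powr (r - 1)"
    using False by (simp add: powr_add powr_realpow)
  ultimately show ?thesis by (simp add: mult_ac)
qed (use assms in \<open>simp add: power_0_left has_bochner_integral_zero\<close>)

text \<open>Trading \<open>n\<close> powers of \<open>t\<close> for powers of \<open>m\<^sub>i = p + i\<close> leaves the exponent \<open>q - n\<close>, which must lie strictly
between \<open>-1\<close> and \<open>1\<close> for the summands to be integrable one by one. Hence \<open>n = 4\<close> for \<open>q > 3\<close> and
\<open>n = 2\<close> for \<open>q < 3\<close>. The sign that comes with the second case is absorbed by the shift of the cosine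
by \<open>\<pi>\<close>.\<close>

lemma symbol_integral_eq_power_sum:
  fixes p q :: real
  assumes "1 < q" "q < 4" "q \<noteq> 3"
  shows "symbol_integral q p = pi / (2 * Gamma q * cos (pi * q / 2))
       * (\<Sum>i = - 2..2. stencil i * \<bar>p + real_of_int i\<bar> powr (q - 1))" (is "?J = _ * ?S")
proof -
  let ?m = "\<lambda>i. p + real_of_int i"
  let ?R = "\<lambda>t. indicator {0<..} t * (t powr q * (\<Sum>i = - 2..2. stencil i * (1 / (t\<^sup>2 + (?m i)\<^sup>2))))"
  have weighted: "has_bochner_integral lborel
      (\<lambda>t. indicator {0<..} t * (t powr (q - real n) * (\<Sum>i = - 2..2. stencil i * (\<bar>?m i\<bar> ^ n / (t\<^sup>2 + (?m i)\<^sup>2)))))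
      (pi / (2 * cos (pi * (q - real n) / 2)) * ?S)"
    if "-1 < q - real n" "q - real n < 1" "n > 0" for n
  proof -
    have "has_bochner_integral lborel
      (\<lambda>t. \<Sum>i = - 2..2. stencil i * (indicator {0<..} t * (t powr (q - real n) * (\<bar>?m i\<bar> ^ n / (t\<^sup>2 + (?m i)\<^sup>2)))))
      (\<Sum>i = - 2..2. stencil i * (\<bar>?m i\<bar> powr (q - real n - 1 + n) * pi / (2 * cos (pi * (q - real n) / 2))))"
      using that
      by (intro has_bochner_integral_sum has_bochner_integral_mult_right
          has_bochner_integral_weighted_resolvent) auto
    then show ?thesis by (simp add: sum_distrib_left mult_ac)
  qed
  have laplace: "has_bochner_integral lborel ?R (Gamma q * ?J)"
    using assms by (intro has_bochner_integral_stencil_resolvent) auto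
  have "Gamma q * ?J = pi / (2 * cos (pi * q / 2)) * ?S"
  proof (cases "q > 3")
    case True
    have R: "?R t = indicator {0<..} t * (t powr (q - real 4) * (\<Sum>i = - 2..2. stencil i * (\<bar>?m i\<bar> ^ 4 / (t\<^sup>2 + (?m i)\<^sup>2))))" for t
    proof (cases "t > 0")
      case True
      then have "t powr q = t powr (q - real 4) * t ^ 4" by (simp add: powr_diff)
      then show ?thesis using sum_stencil_resolvent(2)[OF True, of p] True by (simp add: mult.assoc)
    qed simp
    have "has_bochner_integral lborel ?R (pi / (2 * cos (pi * (q - real 4) / 2)) * ?S)"
      unfolding R using assms True by (intro weighted) auto
    with laplace have "Gamma q * ?J = pi / (2 * cos (pi * (q - real 4) / 2)) * ?S"
      by (rule has_bochner_integral_eq)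
    also have "cos (pi * (q - real 4) / 2) = cos (pi * q / 2 - 2 * pi)"
      by (simp add: algebra_simps diff_divide_distrib)
    also have "\<dots> = cos (pi * q / 2)" by (simp add: cos_diff)
    finally show ?thesis .
  next
    case False
    have R: "?R t = - (indicator {0<..} t * (t powr (q - real 2) * (\<Sum>i = - 2..2. stencil i * (\<bar>?m i\<bar> ^ 2 / (t\<^sup>2 + (?m i)\<^sup>2)))))" for t
    proof (cases "t > 0")
      case True
      then have "t powr q = t powr (q - real 2) * t ^ 2" by (simp add: powr_diff)
      then show ?thesis using sum_stencil_resolvent(1)[OF True, of p] True by (simp add: mult.assoc)
    qed simp
    have "has_bochner_integral lborel ?R (- (pi / (2 * cos (pi * (q - real 2) / 2)) * ?S))"
      unfolding R using assms False by (intro has_bochner_integral_minus weighted) auto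
    with laplace have "Gamma q * ?J = - (pi / (2 * cos (pi * (q - real 2) / 2)) * ?S)"
      by (rule has_bochner_integral_eq)
    also have "cos (pi * (q - real 2) / 2) = cos (pi * q / 2 - pi)"
      by (simp add: algebra_simps diff_divide_distrib)
    also have "\<dots> = - cos (pi * q / 2)" by (simp add: cos_diff)
    finally show ?thesis by simp
  qed
  moreover have "Gamma q > 0" using assms by (intro Gamma_real_pos) auto
  moreover have "symbol_integral q p = Gamma q * symbol_integral q p / Gamma q"
    using \<open>Gamma q > 0\<close> by simp
  ultimately show ?thesis by simp
qed

text \<open>After trading two powers the integrand is \<open>- (\<Sum>i. c\<^sub>i m\<^sub>i\<^sup>2 t / (t\<^sup>2 + m\<^sub>i\<^sup>2))\<close>, whose summands decay only like
\<open>1 / t\<close>. Integrability of the sum is known already, so it suffices to know the limits of the primitive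
\<open>- 1/2 (\<Sum>i. c\<^sub>i m\<^sub>i\<^sup>2 ln (t\<^sup>2 + m\<^sub>i\<^sup>2))\<close> at both ends.\<close>

lemma symbol_integral_three_eq_log_sum:
  fixes p :: real
  shows "symbol_integral 3 p
     = 1 / 2 * (\<Sum>i = - 2..2. stencil i * (p + real_of_int i)\<^sup>2 * ln \<bar>p + real_of_int i\<bar>)"
    (is "?J = _")
proof -
  let ?m = "\<lambda>i. p + real_of_int i"
  let ?f = "\<lambda>t. - (\<Sum>i = - 2..2. stencil i * ((?m i)\<^sup>2 * (t / (t\<^sup>2 + (?m i)\<^sup>2))))"
  let ?F = "\<lambda>t. - (1 / 2) * (\<Sum>i = - 2..2. stencil i * ((?m i)\<^sup>2 * ln (t\<^sup>2 + (?m i)\<^sup>2)))"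
  have "indicator {0<..} t * (t powr 3 * (\<Sum>i = - 2..2. stencil i * (1 / (t\<^sup>2 + (?m i)\<^sup>2))))
      = indicator {0<..} t * ?f t" for t
  proof (cases "t > 0")
    case True
    then have "t powr 3 = t * t\<^sup>2" by (simp add: power3_eq_cube power2_eq_square)
    then show ?thesis using sum_stencil_resolvent(1)[OF True, of p]
      by (simp add: mult.assoc) (simp add: sum_distrib_left mult_ac)
  qed simp
  with has_bochner_integral_stencil_resolvent[of 3 p]
  have I: "has_bochner_integral lborel (\<lambda>t. indicator {0<..} t * ?f t) (Gamma 3 * ?J)" by simp
  have "(LBINT t=0..\<infinity>. ?f t) = 0 - (- (1 / 2) * (\<Sum>i = - 2..2. stencil i * ((?m i)\<^sup>2 * ln ((?m i)\<^sup>2))))"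
  proof (rule interval_integral_FTC_integrable[where F = ?F])
    show "set_integrable lborel (einterval 0 \<infinity>) ?f"
      using I by (simp add: einterval_0_infinity set_integrable_def has_bochner_integral_iff)
    have pos: "t\<^sup>2 + x\<^sup>2 > 0" if "t > 0" for t x :: real
      using that by (simp add: add_pos_nonneg)
    show "(?F has_vector_derivative ?f t) (at t)" if "0 < ereal t" for t
    proof -
      have t: "t > 0" using that by simp
      have "((\<lambda>t. stencil i * ((?m i)\<^sup>2 * ln (t\<^sup>2 + (?m i)\<^sup>2))) has_real_derivative
           2 * (stencil i * ((?m i)\<^sup>2 * (t / (t\<^sup>2 + (?m i)\<^sup>2))))) (at t)" for i
        using pos[OF t, of "?m i"] by (auto intro!: derivative_eq_intros)
      then have "((\<lambda>t. \<Sum>i = - 2..2. stencil i * ((?m i)\<^sup>2 * ln (t\<^sup>2 + (?m i)\<^sup>2))) has_real_derivative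
           (\<Sum>i = - 2..2. 2 * (stencil i * ((?m i)\<^sup>2 * (t / (t\<^sup>2 + (?m i)\<^sup>2)))))) (at t)"
        by (intro DERIV_sum)
      from DERIV_cmult[OF this, of "- (1/2)"]
      have "(?F has_real_derivative ?f t) (at t)"
        unfolding sum_distrib_left[symmetric] by simp
      then show ?thesis by (simp add: has_real_derivative_iff_has_vector_derivative)
    qed
    show "isCont ?f t" if "0 < ereal t" for t
      using pos[of t] that by (auto intro!: continuous_intros simp: less_imp_neq[symmetric])
    have term0: "((\<lambda>t. x\<^sup>2 * ln (t\<^sup>2 + x\<^sup>2)) \<longlongrightarrow> x\<^sup>2 * ln (x\<^sup>2)) (at_right 0)" for x :: real
    proof (cases "x = 0")
      case False
      then have "((\<lambda>t. x\<^sup>2 * ln (t\<^sup>2 + x\<^sup>2)) \<longlongrightarrow> x\<^sup>2 * ln (0\<^sup>2 + x\<^sup>2)) (at_right 0)"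
        by (intro tendsto_intros) auto
      then show ?thesis by simp
    qed simp
    have "(?F \<longlongrightarrow> - (1 / 2) * (\<Sum>i = - 2..2. stencil i * ((?m i)\<^sup>2 * ln ((?m i)\<^sup>2)))) (at_right 0)"
      by (intro tendsto_mult_left tendsto_sum term0)
    then have "((?F \<circ> real_of_ereal) \<longlongrightarrow> - (1 / 2) * (\<Sum>i = - 2..2. stencil i * ((?m i)\<^sup>2 * ln ((?m i)\<^sup>2)))) (at_right (ereal 0))"
      unfolding ereal_tendsto_simps .
    then show "((?F \<circ> real_of_ereal) \<longlongrightarrow> - (1 / 2) * (\<Sum>i = - 2..2. stencil i * ((?m i)\<^sup>2 * ln ((?m i)\<^sup>2)))) (at_right 0)"
      by (simp only: zero_ereal_def)
    \<comment> \<open>Each logarithm diverges at infinity; subtracting the common term \<open>ln (t\<^sup>2)\<close> leaves the stencil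
      sum unchanged, as the stencil annihilates \<open>m\<^sub>i\<^sup>2\<close>.\<close>
    have "((\<lambda>t. - (1 / 2) * (\<Sum>i = - 2..2. stencil i * ((?m i)\<^sup>2 * (ln (t\<^sup>2 + (?m i)\<^sup>2) - ln (t\<^sup>2)))))
        \<longlongrightarrow> - (1 / 2) * (\<Sum>i = - 2..2. stencil i * ((?m i)\<^sup>2 * 0))) at_top"
    proof (intro tendsto_mult_left tendsto_sum)
      show "((\<lambda>t. ln (t\<^sup>2 + x\<^sup>2) - ln (t\<^sup>2)) \<longlongrightarrow> 0) at_top" for x :: real
        by real_asymp
    qed
    moreover have "(\<Sum>i = - 2..2. stencil i * ((?m i)\<^sup>2 * (ln (t\<^sup>2 + (?m i)\<^sup>2) - ln (t\<^sup>2))))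
        = (\<Sum>i = - 2..2. stencil i * ((?m i)\<^sup>2 * ln (t\<^sup>2 + (?m i)\<^sup>2)))" for t
    proof -
      have "(\<Sum>i = - 2..2. stencil i * ((?m i)\<^sup>2 * (ln (t\<^sup>2 + (?m i)\<^sup>2) - ln (t\<^sup>2))))
        = (\<Sum>i = - 2..2. stencil i * ((?m i)\<^sup>2 * ln (t\<^sup>2 + (?m i)\<^sup>2)))
          - (\<Sum>i = - 2..2. stencil i * (?m i)\<^sup>2) * ln (t\<^sup>2)"
        by (simp only: sum_distrib_right right_diff_distrib sum_subtractf mult.assoc)
      then show ?thesis unfolding sum_stencil_square by simp
    qed
    ultimately show "((?F \<circ> real_of_ereal) \<longlongrightarrow> 0) (at_left \<infinity>)"
      unfolding ereal_tendsto_simps by simp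
  qed simp
  then have "(LINT t|lborel. indicator {0<..} t * ?f t) = 1 / 2 * (\<Sum>i = - 2..2. stencil i * ((?m i)\<^sup>2 * ln ((?m i)\<^sup>2)))"
    by (simp only: interval_lebesgue_integral_0_infty set_lebesgue_integral_def einterval_0_infinity real_scaleR_def)
  also have "\<dots> = (\<Sum>i = - 2..2. stencil i * (?m i)\<^sup>2 * ln \<bar>?m i\<bar>)"
  proof -
    have sq: "x\<^sup>2 * ln (x\<^sup>2) = 2 * (x\<^sup>2 * ln \<bar>x\<bar>)" for x :: real
      using ln_realpow[of "\<bar>x\<bar>" 2] by (cases "x = 0") auto
    show ?thesis unfolding sq sum_distrib_left by (intro sum.cong) auto
  qed
  finally have "Gamma 3 * ?J = (\<Sum>i = - 2..2. stencil i * (?m i)\<^sup>2 * ln \<bar>?m i\<bar>)"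
    using has_bochner_integral_integral_eq[OF I] by simp
  moreover have "Gamma 3 = (2 :: real)"
    using Gamma_fact[of 2, where 'a = real] by (simp add: fact_numeral)
  ultimately show ?thesis by simp
qed



section \<open>Fourier transform of the hat functions\<close>

lemma has_bochner_integral_affine_times_exp:
  fixes \<alpha> \<beta> k :: complex and l u :: real
  assumes "l \<le> u" "k \<noteq> 0"
  defines "F \<equiv> \<lambda>x. ((\<alpha> + \<beta> * of_real x) / k - \<beta> / k\<^sup>2) * exp (k * of_real x)"
  shows "has_bochner_integral lborel
           (\<lambda>x. indicator {l..u} x *\<^sub>R ((\<alpha> + \<beta> * of_real x) * exp (k * of_real x))) (F u - F l)"
proof (rule has_bochner_integral_FTC_Icc)
  show "(F has_vector_derivative (\<alpha> + \<beta> * of_real x) * exp (k * of_real x)) (at x within {l..u})" for x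
  proof -
    have "((\<lambda>z. ((\<alpha> + \<beta> * z) / k - \<beta> / k\<^sup>2) * exp (k * z)) has_field_derivative
        (\<alpha> + \<beta> * of_real x) * exp (k * of_real x)) (at (of_real x))"
      using assms(2)
      by (auto intro!: derivative_eq_intros simp: field_simps power2_eq_square)
    then show ?thesis unfolding F_def by (rule has_vector_derivative_real_field)
  qed
  show "continuous_on {l..u} (\<lambda>x. (\<alpha> + \<beta> * complex_of_real x) * exp (k * of_real x))"
    by (intro continuous_intros)
qed fact

text \<open>Integrating the two linear pieces exactly, the boundary terms of first order cancel at the middle node
by continuity of the hat, and the others form \<open>1 / (h k\<^sup>2)\<close> times the second difference of
\<open>exp (k x)\<close> over the three nodes, where \<open>k = - \<i> \<xi>\<close>.\<close>

lemma fourier_hat_eq: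
  fixes a b \<xi> :: real and N j :: nat
  assumes "a < b" "0 < N" "1 \<le> j" "\<xi> \<noteq> 0"
  defines "h \<equiv> mesh_size a b N"
  shows "fourier (\<lambda>x. of_real (hat a b N j x)) \<xi> =
     of_real ((2 - 2 * cos (h * \<xi>)) / (sqrt (2 * pi) * h * \<xi>\<^sup>2)) * cis (- (node a b N j * \<xi>))"
proof -
  define c where "c = node a b N j"
  define k where "k = - \<i> * complex_of_real \<xi>"
  have h: "h > 0" using assms by (simp add: h_def mesh_size_def)
  have k: "k \<noteq> 0" using assms by (simp add: k_def)
  have nodes: "node a b N (j - 1) = c - h" "node a b N (j + 1) = c + h"
    using assms(3) by (simp_all add: node_def c_def h_def algebra_simps of_nat_diff)
  have hat: "hat a b N j x = (if c - h \<le> x \<and> x \<le> c then (x - (c - h)) / h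
      else if c \<le> x \<and> x \<le> c + h then (c + h - x) / h else 0)" for x
    unfolding hat_def nodes c_def[symmetric] h_def[symmetric] ..
  have [measurable]: "hat a b N j \<in> borel_measurable borel"
    unfolding hat[abs_def] by measurable
  \<comment> \<open>The closed pieces share the middle node \<open>c\<close>, so their sum agrees with the hat only almost everywhere.\<close>
  let ?L = "\<lambda>x. indicator {c - h..c} x *\<^sub>R
     ((of_real (- (c - h) / h) + of_real (1 / h) * of_real x) * exp (k * of_real x))"
  let ?R = "\<lambda>x. indicator {c..c + h} x *\<^sub>R
     ((of_real ((c + h) / h) + of_real (- 1 / h) * of_real x) * exp (k * of_real x))"
  note int_L = has_bochner_integral_affine_times_exp[of "c - h" c k
      "of_real (- (c - h) / h)" "of_real (1 / h)", OF _ k]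
  note int_R = has_bochner_integral_affine_times_exp[of c "c + h" k
      "of_real ((c + h) / h)" "of_real (- 1 / h)", OF _ k]
  have int_LR: "has_bochner_integral lborel (\<lambda>x. ?L x + ?R x)
      (((of_real 1 / k - of_real (1 / h) / k\<^sup>2) * exp (k * of_real c)
        - (of_real 0 / k - of_real (1 / h) / k\<^sup>2) * exp (k * of_real (c - h)))
      + ((of_real 0 / k - of_real (- 1 / h) / k\<^sup>2) * exp (k * of_real (c + h))
        - (of_real 1 / k - of_real (- 1 / h) / k\<^sup>2) * exp (k * of_real c)))" (is "has_bochner_integral _ _ ?I")
  proof -
    have affine: "of_real (- (c - h) / h) + of_real (1 / h) * of_real x = complex_of_real ((x - (c - h)) / h)"
      "of_real ((c + h) / h) + of_real (- 1 / h) * of_real x = complex_of_real ((c + h - x) / h)" for x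
      using h unfolding of_real_mult[symmetric] of_real_add[symmetric]
      by (simp_all add: field_simps)
    have "has_bochner_integral lborel (\<lambda>x. ?L x + ?R x)
      (((of_real ((c - (c - h)) / h) / k - of_real (1 / h) / k\<^sup>2) * exp (k * of_real c)
        - (of_real ((c - h - (c - h)) / h) / k - of_real (1 / h) / k\<^sup>2) * exp (k * of_real (c - h)))
      + ((of_real ((c + h - (c + h)) / h) / k - of_real (- 1 / h) / k\<^sup>2) * exp (k * of_real (c + h))
        - (of_real ((c + h - c) / h) / k - of_real (- 1 / h) / k\<^sup>2) * exp (k * of_real c)))"
      using has_bochner_integral_add[OF int_L int_R] h unfolding affine by simp
    then show ?thesis using h by simp
  qed
  have "(LINT x|lborel. of_real (hat a b N j x) * exp (- \<i> * of_real \<xi> * of_real x))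
      = (LINT x|lborel. ?L x + ?R x)"
  proof (rule integral_cong_AE)
    show "AE x in lborel. of_real (hat a b N j x) * exp (- \<i> * of_real \<xi> * of_real x) = ?L x + ?R x"
      using AE_lborel_singleton[of c]
    proof eventually_elim
      case (elim x)
      then show ?case using h
        by (auto simp: hat k_def indicator_def field_simps)
    qed
  qed measurable
  also have "\<dots> = ?I" by (rule has_bochner_integral_integral_eq[OF int_LR])
  also have "\<dots> = of_real (1 / h) / k\<^sup>2 * (exp (k * of_real h) + exp (- (k * of_real h)) - 2) * exp (k * of_real c)"
    by (simp add: algebra_simps exp_add exp_diff exp_minus divide_inverse)
  also have "exp (k * of_real h) + exp (- (k * of_real h)) = of_real (2 * cos (h * \<xi>))"
  proof -
    have "exp (k * of_real h) = cis (- (h * \<xi>))" "exp (- (k * of_real h)) = cis (h * \<xi>)"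
      by (simp_all add: k_def cis_conv_exp mult_ac)
    then show ?thesis by (simp add: complex_eq_iff)
  qed
  also have "exp (k * of_real c) = cis (- (c * \<xi>))"
    by (simp add: k_def cis_conv_exp mult_ac)
  also have "k\<^sup>2 = - of_real (\<xi>\<^sup>2)" by (simp add: k_def power_mult_distrib)
  also have "of_real (1 / h) / - of_real (\<xi>\<^sup>2) * (of_real (2 * cos (h * \<xi>)) - 2) * cis (- (c * \<xi>))
      = of_real ((2 - 2 * cos (h * \<xi>)) / (h * \<xi>\<^sup>2)) * cis (- (c * \<xi>))"
    using h assms(4) by (simp add: field_simps)
  finally show ?thesis unfolding fourier_def c_def by (simp add: field_simps)
qed

section \<open>Entries of the stiffness matrix\<close>

text \<open>At \<open>\<xi> = 0\<close> both sides vanish because \<open>0 powr y = 0\<close>, so the identity holds everywhere, and an integral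
over the line can be rewritten with it directly.\<close>

lemma stiffness_integrand_eq:
  fixes a b s :: real and N k j :: nat
  assumes "a < b" "0 < N" "1 \<le> k" "1 \<le> j"
  defines "h \<equiv> mesh_size a b N"
  shows "stiffness_integrand a b N s k j \<xi> = of_real (h powr (2 - 2 * s) / (2 * pi)) *
      (of_real (\<bar>h * \<xi>\<bar> powr (2 * s - 4) * (2 - 2 * cos (h * \<xi>))\<^sup>2) * cis ((real k - real j) * (h * \<xi>)))"
proof (cases "\<xi> = 0")
  case True
  then show ?thesis by (simp add: stiffness_integrand_def)
next
  case False
  have h: "h > 0" using assms by (simp add: h_def mesh_size_def)
  let ?A = "(2 - 2 * cos (h * \<xi>)) / (sqrt (2 * pi) * h * \<xi>\<^sup>2)"
  have "stiffness_integrand a b N s k j \<xi> = of_real (\<bar>\<xi>\<bar> powr (2 * s)) *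
     (of_real ?A * cis (- (node a b N j * \<xi>))) * cnj (of_real ?A * cis (- (node a b N k * \<xi>)))"
    unfolding stiffness_integrand_def h_def
      fourier_hat_eq[OF assms(1,2,4) False] fourier_hat_eq[OF assms(1,2,3) False] ..
  also have "\<dots> = of_real (\<bar>\<xi>\<bar> powr (2 * s) * ?A\<^sup>2) * (cis (- (node a b N j * \<xi>)) * cis (node a b N k * \<xi>))"
    by (simp add: cis_cnj power2_eq_square)
  also have "cis (- (node a b N j * \<xi>)) * cis (node a b N k * \<xi>) = cis ((real k - real j) * (h * \<xi>))"
    by (simp add: cis_mult node_def h_def algebra_simps)
  also have "\<bar>\<xi>\<bar> powr (2 * s) * ?A\<^sup>2
      = h powr (2 - 2 * s) / (2 * pi) * (\<bar>h * \<xi>\<bar> powr (2 * s - 4) * (2 - 2 * cos (h * \<xi>))\<^sup>2)"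
  proof -
    have "\<bar>h * \<xi>\<bar> powr (2 * s - 4) = h powr (2 * s - 4) * \<bar>\<xi>\<bar> powr (2 * s - 4)"
      using h by (simp add: abs_mult powr_mult)
    moreover have "h powr (2 - 2 * s) * h powr (2 * s - 4) = 1 / h\<^sup>2"
      using h by (simp add: powr_minus_divide flip: powr_add)
    moreover have "\<bar>\<xi>\<bar> powr (2 * s - 4) = \<bar>\<xi>\<bar> powr (2 * s) / (\<xi>\<^sup>2)\<^sup>2"
      using False by (simp add: powr_diff flip: power_mult)
    ultimately have "h powr (2 - 2 * s) * \<bar>h * \<xi>\<bar> powr (2 * s - 4)
        = 1 / h\<^sup>2 * (\<bar>\<xi>\<bar> powr (2 * s) / (\<xi>\<^sup>2)\<^sup>2)"
      by (metis mult.assoc)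
    then have "h powr (2 - 2 * s) / (2 * pi) * (\<bar>h * \<xi>\<bar> powr (2 * s - 4) * (2 - 2 * cos (h * \<xi>))\<^sup>2)
        = 1 / h\<^sup>2 * (\<bar>\<xi>\<bar> powr (2 * s) / (\<xi>\<^sup>2)\<^sup>2) / (2 * pi) * (2 - 2 * cos (h * \<xi>))\<^sup>2"
      by (metis (no_types, lifting) mult.assoc times_divide_eq_left)
    then show ?thesis by (simp add: power_divide power_mult_distrib)
  qed
  finally show ?thesis by simp
qed

lemma has_bochner_integral_halves:
  fixes f :: "real \<Rightarrow> 'a :: {banach, second_countable_topology}"
  assumes [measurable]: "f \<in> borel_measurable borel"
    and "has_bochner_integral lborel (\<lambda>x. indicator {0<..} x *\<^sub>R f x) I"
    and "has_bochner_integral lborel (\<lambda>x. indicator {0<..} x *\<^sub>R f (- x)) J"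
  shows "has_bochner_integral lborel f (I + J)"
proof -
  have "has_bochner_integral lborel (\<lambda>x. indicator {0<..} (- x) *\<^sub>R f x) J"
    using lborel_has_bochner_integral_real_affine_iff[of "- 1" "\<lambda>x. indicator {0<..} x *\<^sub>R f (- x)" J 0] assms(3)
    by simp
  from has_bochner_integral_add[OF assms(2) this]
  have "has_bochner_integral lborel (\<lambda>x. indicator {0<..} x *\<^sub>R f x + indicator {0<..} (- x) *\<^sub>R f x) (I + J)" .
  moreover have "AE x in lborel. indicator {0<..} x *\<^sub>R f x + indicator {0<..} (- x) *\<^sub>R f x = f x"
    using AE_lborel_singleton[of 0] by eventually_elim (auto simp: indicator_def)
  ultimately show ?thesis
    by (subst has_bochner_integral_cong_AE[symmetric]) auto
qed

text \<open>The integrand takes conjugate values at \<open>x\<close> and \<open>-x\<close>, so its integral over the line is twice the real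
part of its integral over the half-line.\<close>

lemma has_bochner_integral_symbol_times_cis:
  fixes q d :: real
  assumes "1 < q" "q < 5"
  shows "has_bochner_integral lborel
           (\<lambda>x. of_real (\<bar>x\<bar> powr (- q) * (2 - 2 * cos x)\<^sup>2) * cis (d * x))
           (of_real (2 * symbol_integral q d))"
proof -
  let ?K = "\<lambda>x::real. \<bar>x\<bar> powr (- q) * (2 - 2 * cos x)\<^sup>2"
  let ?G = "\<lambda>x. of_real (?K x) * cis (d * x)"
  have [measurable]: "(\<lambda>x. cis (d * x)) \<in> borel_measurable borel"
    by (intro borel_measurable_continuous_onI continuous_intros)
  have norm_G: "norm (?G x) = ?K x" for x
    by (simp only: norm_mult norm_of_real norm_cis) (simp add: abs_mult)
  define I where "I = (LINT x|lborel. indicator {0<..} x *\<^sub>R ?G x)"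
  have "integrable lborel (\<lambda>x. indicator {0<..} x *\<^sub>R ?G x)"
    by (rule Bochner_Integration.integrable_bound[OF integrable_powr_minus_times_one_minus_cos[OF assms]])
      (auto simp: norm_G indicator_def intro!: AE_I2 simp del: of_real_mult of_real_power)
  then have I: "has_bochner_integral lborel (\<lambda>x. indicator {0<..} x *\<^sub>R ?G x) I"
    by (simp add: has_bochner_integral_iff I_def)
  have reflect: "(\<lambda>x. indicator {0<..} x *\<^sub>R ?G (- x)) = (\<lambda>x. cnj (indicator {0<..} x *\<^sub>R ?G x))"
    by (simp add: cis_cnj fun_eq_iff)
  have "has_bochner_integral lborel (\<lambda>x. indicator {0<..} x *\<^sub>R ?G (- x)) (cnj I)"
    unfolding reflect by (rule has_bochner_integral_bounded_linear[OF bounded_linear_cnj I])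
  from has_bochner_integral_halves[OF _ I this]
  have "has_bochner_integral lborel ?G (I + cnj I)" by simp
  also have "I + cnj I = of_real (2 * Re I)" by (simp add: complex_add_cnj)
  also have "Re I = symbol_integral q d"
    unfolding symbol_integral_def
    using has_bochner_integral_bounded_linear[OF bounded_linear_Re I]
    by (subst has_bochner_integral_integral_eq[symmetric], assumption)
      (auto intro!: Bochner_Integration.integral_cong simp: indicator_def)
  finally show ?thesis .
qed

lemma symbol_integral_abs: "symbol_integral q \<bar>p\<bar> = symbol_integral q p"
proof -
  have "cos (\<bar>p\<bar> * x) = cos (p * x)" for x by (simp add: abs_if)
  then show ?thesis by (simp add: symbol_integral_def)
qed

lemma has_bochner_integral_stiffness_integrand:
  fixes a b s :: real and N k j :: nat
  assumes "a < b" "0 < N" "1 \<le> k" "1 \<le> j" "0 < s" "s < 3 / 2"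
  shows "has_bochner_integral lborel (stiffness_integrand a b N s k j)
     (of_real (mesh_size a b N powr (1 - 2 * s) / pi * symbol_integral (4 - 2 * s) (index_dist k j)))"
proof -
  define h where "h = mesh_size a b N"
  have h: "h > 0" using assms by (simp add: h_def mesh_size_def)
  let ?G = "\<lambda>x. of_real (\<bar>x\<bar> powr (- (4 - 2 * s)) * (2 - 2 * cos x)\<^sup>2) * cis ((real k - real j) * x)"
  let ?S = "symbol_integral (4 - 2 * s) (real k - real j)"
  have "has_bochner_integral lborel ?G (of_real (2 * ?S))"
    using assms by (intro has_bochner_integral_symbol_times_cis) auto
  from lborel_has_bochner_integral_real_affine_iff[of h, THEN iffD1, OF _ this, of 0]
  have "has_bochner_integral lborel (\<lambda>\<xi>. ?G (h * \<xi>)) (of_real (2 * ?S) /\<^sub>R h)"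
    using h by simp
  then have "has_bochner_integral lborel (\<lambda>\<xi>. of_real (h powr (2 - 2 * s) / (2 * pi)) * ?G (h * \<xi>))
      (of_real (h powr (2 - 2 * s) / (2 * pi)) * (of_real (2 * ?S) /\<^sub>R h))"
    by (intro has_bochner_integral_mult_right)
  also have "(\<lambda>\<xi>. of_real (h powr (2 - 2 * s) / (2 * pi)) * ?G (h * \<xi>)) = stiffness_integrand a b N s k j"
    using assms by (simp add: fun_eq_iff stiffness_integrand_eq h_def)
  also have "of_real (h powr (2 - 2 * s) / (2 * pi)) * (of_real (2 * ?S) /\<^sub>R h)
      = complex_of_real (h powr (2 - 2 * s) / h / pi * ?S)"
    using h by (simp add: scaleR_conv_of_real field_simps)
  also have "h powr (2 - 2 * s) / h = h powr (1 - 2 * s)"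
    using h by (simp add: powr_diff power2_eq_square)
  also have "?S = symbol_integral (4 - 2 * s) (index_dist k j)"
  proof -
    have "real (index_dist k j) = \<bar>real k - real j\<bar>" by (simp add: index_dist_def)
    then show ?thesis by (simp add: symbol_integral_abs)
  qed
  finally show ?thesis by (simp add: h_def)
qed

text \<open>At \<open>\<sigma> = 1/2\<close> the numerator is the fourth difference of a quadratic polynomial, hence zero, and so is the
cosine. Dividing both by \<open>\<sigma> - 1/2\<close> shows that the limit is the quotient of their derivatives.\<close>

lemma tendsto_toeplitz_gen_over_cos:
  "((\<lambda>\<sigma>. toeplitz_gen \<sigma> p / cos (\<sigma> * pi)) \<longlongrightarrow> 2 / pi * log_toeplitz_gen p) (at (1 / 2))"
proof -
  let ?m = "\<lambda>i. \<bar>real_of_int (int p + i)\<bar>"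
  have zero: "toeplitz_gen (1 / 2) p = 0"
    using sum_stencil_square[of "real p"] by (simp add: toeplitz_gen_def)
  have "((\<lambda>\<sigma>. stencil i * ?m i powr (3 - 2 * \<sigma>)) has_real_derivative
      - 2 * (stencil i * (real_of_int (int p + i))\<^sup>2 * ln (?m i))) (at (1 / 2))" for i
  proof (cases "int p + i = 0")
    case False
    then have "?m i > 0" by linarith
    then have "((\<lambda>\<sigma>. stencil i * ?m i powr (3 - 2 * \<sigma>)) has_real_derivative
      stencil i * (?m i powr (3 - 2 * (1 / 2)) * (ln (?m i) * - 2))) (at (1 / 2))"
      by (auto intro!: derivative_eq_intros)
    then show ?thesis using \<open>?m i > 0\<close> by (simp add: mult_ac)
  qed simp
  then have "((\<lambda>\<sigma>. toeplitz_gen \<sigma> p) has_real_derivative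
     (\<Sum>i = - 2..2. - 2 * (stencil i * (real_of_int (int p + i))\<^sup>2 * ln (?m i)))) (at (1 / 2))"
    unfolding toeplitz_gen_def by (intro DERIV_sum)
  then have num: "((\<lambda>\<sigma>. toeplitz_gen \<sigma> p / (\<sigma> - 1 / 2)) \<longlongrightarrow> - 2 * log_toeplitz_gen p) (at (1 / 2))"
    unfolding has_field_derivative_iff log_toeplitz_gen_def sum_distrib_left[symmetric] by (simp add: zero)
  have "((\<lambda>\<sigma>. cos (\<sigma> * pi)) has_real_derivative - pi) (at (1 / 2))"
    by (auto intro!: derivative_eq_intros)
  then have den: "((\<lambda>\<sigma>. cos (\<sigma> * pi) / (\<sigma> - 1 / 2)) \<longlongrightarrow> - pi) (at (1 / 2))"
    unfolding has_field_derivative_iff by simp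
  have "((\<lambda>\<sigma>. (toeplitz_gen \<sigma> p / (\<sigma> - 1 / 2)) / (cos (\<sigma> * pi) / (\<sigma> - 1 / 2)))
      \<longlongrightarrow> - 2 * log_toeplitz_gen p / - pi) (at (1 / 2))"
    by (intro tendsto_divide num den) simp
  moreover have "\<forall>\<^sub>F \<sigma> in at (1 / 2). (toeplitz_gen \<sigma> p / (\<sigma> - 1 / 2)) / (cos (\<sigma> * pi) / (\<sigma> - 1 / 2))
      = toeplitz_gen \<sigma> p / cos (\<sigma> * pi)"
    unfolding eventually_at_filter by (intro always_eventually) auto
  ultimately have "((\<lambda>\<sigma>. toeplitz_gen \<sigma> p / cos (\<sigma> * pi)) \<longlongrightarrow> - 2 * log_toeplitz_gen p / - pi) (at (1 / 2))"
    by (rule Lim_transform_eventually)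
  then show ?thesis by simp
qed

theorem theorem1:
  fixes a b s :: real and N :: nat
  assumes "a < b" and "N \<ge> 2" and "0 < s" and "s < 3 / 2"
  shows "(\<forall>k\<in>{1..N - 1}. \<forall>j\<in>{1..N - 1}.
            integrable lborel (stiffness_integrand a b N s k j)) \<and>
         symmetric_mat (stiffness_mat a b N s) \<and>
         toeplitz_mat (stiffness_mat a b N s) \<and>
         (s \<noteq> 1 / 2 \<longrightarrow>
           (\<forall>k\<in>{1..N - 1}. \<forall>j\<in>{1..N - 1}.
             stiffness_mat a b N s $$ (k - 1, j - 1) =
               of_real (mesh_size a b N powr (1 - 2 * s) / (2 * Gamma (4 - 2 * s) * cos (s * pi))
                        * toeplitz_gen s (index_dist k j)))) \<and>
         (s = 1 / 2 \<longrightarrow>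
           (\<forall>k\<in>{1..N - 1}. \<forall>j\<in>{1..N - 1}. \<exists>L.
             ((\<lambda>\<sigma>. toeplitz_gen \<sigma> (index_dist k j) / cos (\<sigma> * pi)) \<longlongrightarrow> L) (at (1 / 2)) \<and>
             stiffness_mat a b N s $$ (k - 1, j - 1) = of_real (1 / 4 * L) \<and>
             1 / 4 * L = 1 / (2 * pi) * log_toeplitz_gen (index_dist k j)))"
proof -
  let ?h = "mesh_size a b N" and ?A = "stiffness_mat a b N s"
  let ?t = "\<lambda>p. ?h powr (1 - 2 * s) / pi * symbol_integral (4 - 2 * s) (real p)"
  have h: "?h > 0" using assms by (simp add: mesh_size_def)
  have int: "has_bochner_integral lborel (stiffness_integrand a b N s k j) (of_real (?t (index_dist k j)))"
    if "1 \<le> k" "1 \<le> j" for k j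
    using assms that by (intro has_bochner_integral_stiffness_integrand) auto
  have entry0: "?A $$ (k, j) = of_real (?t (index_dist (k + 1) (j + 1)))" if "k < N - 1" "j < N - 1" for k j
    using that has_bochner_integral_integral_eq[OF int[of "k + 1" "j + 1"]]
    by (simp add: stiffness_mat_def)
  have entry: "?A $$ (k - 1, j - 1) = of_real (?t (index_dist k j))"
    if "k \<in> {1..N - 1}" "j \<in> {1..N - 1}" for k j
    using that entry0[of "k - 1" "j - 1"] by auto
  have dim: "dim_row ?A = N - 1" "dim_col ?A = N - 1" by (simp_all add: stiffness_mat_def)
  have symmetric: "symmetric_mat ?A"
    unfolding symmetric_mat_def
    by (rule eq_matI) (auto simp: dim entry0 index_dist_def abs_minus_commute)
  have toeplitz: "toeplitz_mat ?A"
    unfolding toeplitz_mat_def by (auto simp: dim entry0 index_dist_def)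
  have integrable: "\<forall>k\<in>{1..N - 1}. \<forall>j\<in>{1..N - 1}. integrable lborel (stiffness_integrand a b N s k j)"
    using integrable.intros[OF int] by auto
  have power: "?t p = ?h powr (1 - 2 * s) / (2 * Gamma (4 - 2 * s) * cos (s * pi)) * toeplitz_gen s p"
    if "s \<noteq> 1 / 2" for p
  proof -
    have "cos (pi * (4 - 2 * s) / 2) = cos (2 * pi - s * pi)"
      by (simp add: algebra_simps diff_divide_distrib)
    then have cos: "cos (pi * (4 - 2 * s) / 2) = cos (s * pi)" by (simp add: cos_diff)
    have "symbol_integral (4 - 2 * s) (real p)
        = pi / (2 * Gamma (4 - 2 * s) * cos (s * pi)) * toeplitz_gen s p"
      using assms that symbol_integral_eq_power_sum[of "4 - 2 * s" "real p"]
      unfolding cos toeplitz_gen_def by simp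
    then show ?thesis by simp
  qed
  have log: "?t p = 1 / 4 * (2 / pi * log_toeplitz_gen p)" if "s = 1 / 2" for p
  proof -
    have "4 - 2 * s = 3" "1 - 2 * s = 0" using that by simp_all
    then show ?thesis
      using h by (simp add: symbol_integral_three_eq_log_sum log_toeplitz_gen_def)
  qed
  have "\<forall>k\<in>{1..N - 1}. \<forall>j\<in>{1..N - 1}. ?A $$ (k - 1, j - 1) =
      of_real (?h powr (1 - 2 * s) / (2 * Gamma (4 - 2 * s) * cos (s * pi)) * toeplitz_gen s (index_dist k j))"
    if "s \<noteq> 1 / 2"
    using entry power[OF that] by metis
  moreover have "\<exists>L. ((\<lambda>\<sigma>. toeplitz_gen \<sigma> (index_dist k j) / cos (\<sigma> * pi)) \<longlongrightarrow> L) (at (1 / 2)) \<and>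
      ?A $$ (k - 1, j - 1) = of_real (1 / 4 * L) \<and>
      1 / 4 * L = 1 / (2 * pi) * log_toeplitz_gen (index_dist k j)"
    if "s = 1 / 2" "k \<in> {1..N - 1}" "j \<in> {1..N - 1}" for k j
  proof (intro exI conjI)
    show "?A $$ (k - 1, j - 1) = of_real (1 / 4 * (2 / pi * log_toeplitz_gen (index_dist k j)))"
      unfolding entry[OF that(2,3)] log[OF that(1)] ..
  qed (rule tendsto_toeplitz_gen_over_cos, simp)
  ultimately show ?thesis
    using symmetric toeplitz integrable by blast
qed

end
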